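(* Over a field of characteristic $0$, the operad $\mathsf{Ass}$ of associative algebras is not stably Koszul; that is, the morphism of wheeled completions $(\mathsf{Ass}_\infty^\circlearrowright,\delta)\to(\mathsf{Ass}^\circlearrowright,0)$ induced by the minimal resolution $(\mathsf{Ass}_\infty,\delta)\to(\mathsf{Ass},0)$ is not a quasi-isomorphism.
   Context: **Graphs.** An $\mathbb S$-bimodule $E$ is a collection of graded vector spaces $E(m,n)$ with commuting left $\mathbb S_m$- and right $\mathbb S_n$-actions. $\mathfrak G^\circlearrowright(m,n)$ is the set of finite, not necessarily connected, directed graphs with $m$ labelled output legs and $n$ labelled input legs; $\mathfrak G^\uparrow(m,n)$ consists of those without wheels, a wheel being a directed path which begins and ends at the same vertex; internal edges lying on a wheel are called cyclic. $G\langle E\rangle=\big(\bigotimes_v E(Out(v),In(v))\big)_{\mathrm{Aut}\,G}$ is the space of graphs $G$ with internal vertices decorated by $E$. $\mathsf P\langle E\rangle=\bigoplus_{G\in\mathfrak G^\uparrow}G\langle E\rangle$ is the free prop and $\mathsf P^\circlearrowright\langle E\rangle=\bigoplus_{G\in\mathfrak G^\circlearrowright}G\langle E\rangle$. A differential on $\mathsf P\langle E\rangle$ is determined by its values on corollas and extends to $\mathsf P^\circlearrowright\langle E\rangle$ vertex by vertex. **Wheeled completions.** For an operad (or dioperad) $D$ presented as the free one on $E$ modulo relations $I$, the wheeled completion is the prop $D^\circlearrowright=\mathsf P^\circlearrowright\langle E\rangle/\langle I\rangle^\circlearrowright$, where $\langle I\rangle^\circlearrowright$ is spanned by decorated graphs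 for which there is a (possibly empty) set of cyclic edges whose breaking into two legs produces a graph lying in the ideal $\langle I\rangle\subset\mathsf P\langle E\rangle$. A Koszul (di)operad $D$ with minimal resolution $(D_\infty,\delta)\to(D,0)$ is stably Koszul if $(D_\infty^\circlearrowright,\delta)\to(D^\circlearrowright,0)$ is a quasi-isomorphism. $\mathsf{Ass}$ is the operad generated by one binary operation of degree $0$ without symmetry (generators $\mathbb K[\mathbb S_2]$ in arity 2) modulo associativity; $\mathsf{Ass}_\infty$ is its standard minimal resolution. *)

theory Defs
  imports Complex_Main "HOL-Library.Poly_Mapping" "HOL-Combinatorics.Permutations"
begin

section \<open>Free vector spaces\<close>

text \<open>The free vector space on a type \<open>'a\<close> is \<^typ>\<open>'a \<Rightarrow>\<^sub>0 'k\<close>, with basis \<open>single a 1\<close>.\<close>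

definition pscale :: "'k::field \<Rightarrow> ('a \<Rightarrow>\<^sub>0 'k) \<Rightarrow> ('a \<Rightarrow>\<^sub>0 'k)" where
  "pscale c x = Poly_Mapping.map ((*) c) x"

lemma lookup_pscale [simp]: "Poly_Mapping.lookup (pscale c x) a = c * Poly_Mapping.lookup x a"
  by (simp add: pscale_def Poly_Mapping.map.rep_eq when_def)

global_interpretation free_vs: vector_space pscale
  by unfold_locales (auto intro!: poly_mapping_eqI simp: lookup_add algebra_simps)

definition basis :: "'a \<Rightarrow> ('a \<Rightarrow>\<^sub>0 'k::field)" where
  "basis a = Poly_Mapping.single a 1"

definition free_on :: "'a set \<Rightarrow> ('a \<Rightarrow>\<^sub>0 'k::field) set" where
  "free_on A = {x. Poly_Mapping.keys x \<subseteq> A}"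

definition lin :: "('a \<Rightarrow> ('b \<Rightarrow>\<^sub>0 'k)) \<Rightarrow> ('a \<Rightarrow>\<^sub>0 'k::field) \<Rightarrow> ('b \<Rightarrow>\<^sub>0 'k)" where
  "lin f x = (\<Sum>a\<in>Poly_Mapping.keys x. pscale (Poly_Mapping.lookup x a) (f a))"

lemma lin_superset:
  assumes "finite S" "Poly_Mapping.keys x \<subseteq> S"
  shows "lin f x = (\<Sum>a\<in>S. pscale (Poly_Mapping.lookup x a) (f a))"
  unfolding lin_def
  by (rule sum.mono_neutral_left) (use assms in \<open>auto simp: not_in_keys_iff_lookup_eq_zero\<close>)

lemma lin_add: "lin f (x + y) = lin f x + lin f y"
proof -
  let ?S = "Poly_Mapping.keys x \<union> Poly_Mapping.keys y"
  have "Poly_Mapping.keys (x + y) \<subseteq> ?S" by (rule Poly_Mapping.keys_add)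
  then show ?thesis
    by (simp add: lin_superset[of ?S] lookup_add free_vs.scale_left_distrib sum.distrib)
qed

lemma keys_pscale: "Poly_Mapping.keys (pscale c x) \<subseteq> Poly_Mapping.keys x"
  by (auto simp: in_keys_iff)

lemma lin_pscale: "lin f (pscale c x) = pscale c (lin f x)"
  by (simp add: lin_superset[of "Poly_Mapping.keys x"] keys_pscale free_vs.scale_sum_right)

lemma lin_basis [simp]: "lin f (basis a) = f a"
  by (simp add: lin_def basis_def)

lemma lin_0 [simp]: "lin f 0 = 0"
  by (simp add: lin_def)

lemma lin_sum: "finite S \<Longrightarrow> lin f (\<Sum>a\<in>S. g a) = (\<Sum>a\<in>S. lin f (g a))"
  by (induction S rule: finite_induct) (auto simp: lin_add)

lemma lin_lin: "lin f (lin g x) = lin (\<lambda>a. lin f (g a)) x"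
  by (simp add: lin_def[of g] lin_def[of "\<lambda>a. lin f (g a)"] lin_sum lin_pscale)

lemma lin_id_on:
  assumes "\<And>a. a \<in> Poly_Mapping.keys x \<Longrightarrow> f a = basis a"
  shows "lin f x = x"
proof (rule poly_mapping_eqI)
  fix k
  have "Poly_Mapping.lookup (lin f x) k =
      (\<Sum>a\<in>Poly_Mapping.keys x. if a = k then Poly_Mapping.lookup x a else 0)"
    unfolding lin_def lookup_sum
    by (rule sum.cong) (auto simp: assms basis_def lookup_single when_def)
  then show "Poly_Mapping.lookup (lin f x) k = Poly_Mapping.lookup x k"
    by (simp add: in_keys_iff)
qed

lemma subspace_free_on:
  fixes A :: "'a set"
  shows "free_vs.subspace (free_on A :: ('a \<Rightarrow>\<^sub>0 'k::field) set)"
proof -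
  have "x + y \<in> free_on A" if "x \<in> free_on A" "y \<in> free_on A" for x y :: "'a \<Rightarrow>\<^sub>0 'k"
    using that Poly_Mapping.keys_add[of x y] unfolding free_on_def by blast
  moreover have "pscale c x \<in> free_on A" if "x \<in> free_on A" for c and x :: "'a \<Rightarrow>\<^sub>0 'k"
    using that keys_pscale[of c x] unfolding free_on_def by blast
  ultimately show ?thesis
    by (simp add: free_vs.subspace_def) (simp add: free_on_def)
qed

lemma lin_free_on: "(\<And>a. a \<in> A \<Longrightarrow> f a \<in> free_on B) \<Longrightarrow> x \<in> free_on A \<Longrightarrow> lin f x \<in> free_on B"
  unfolding lin_def
  by (intro free_vs.subspace_sum[OF subspace_free_on] free_vs.subspace_scale[OF subspace_free_on])
     (auto simp: free_on_def)

definition ksign :: "int \<Rightarrow> 'k::field" where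
  "ksign d = (if even d then 1 else - 1)"


section \<open>Complexes and quasi-isomorphisms\<close>

text \<open>A record \<open>C\<close> stands for the cochain complex with \<open>i\<close>-th term \<open>chains C i / rels C i\<close>
  and differential of degree \<open>+1\<close> induced by \<open>diff C\<close>. Cocycles and coboundaries are kept as
  subspaces of \<open>chains C i\<close> containing \<open>rels C i\<close>, and a cohomology class is a coset of the
  coboundaries.\<close>

record 'v cochain_complex =
  chains :: "int \<Rightarrow> 'v set"
  rels :: "int \<Rightarrow> 'v set"
  diff :: "'v \<Rightarrow> 'v"

definition cocycles :: "'v::ab_group_add cochain_complex \<Rightarrow> int \<Rightarrow> 'v set" where
  "cocycles C i = {x \<in> chains C i. diff C x \<in> rels C (i + 1)}"

definition coboundaries :: "'v::ab_group_add cochain_complex \<Rightarrow> int \<Rightarrow> 'v set" where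
  "coboundaries C i = {diff C y + r | y r. y \<in> chains C (i - 1) \<and> r \<in> rels C i}"

definition cohomology :: "'v::ab_group_add cochain_complex \<Rightarrow> int \<Rightarrow> 'v set set" where
  "cohomology C i = {(+) z ` coboundaries C i | z. z \<in> cocycles C i}"

definition cohomology_map ::
    "('v::ab_group_add \<Rightarrow> 'w::ab_group_add) \<Rightarrow> 'w cochain_complex \<Rightarrow> int \<Rightarrow> 'v set \<Rightarrow> 'w set" where
  "cohomology_map f D i X = (\<Union>x\<in>X. (+) (f x) ` coboundaries D i)"

definition quasi_isomorphism ::
    "('v::ab_group_add \<Rightarrow> 'w::ab_group_add) \<Rightarrow> 'v cochain_complex \<Rightarrow> 'w cochain_complex \<Rightarrow> bool" where
  "quasi_isomorphism f C D \<longleftrightarrow>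
     (\<forall>i. bij_betw (cohomology_map f D i) (cohomology C i) (cohomology D i))"


section \<open>Graded S-bimodules\<close>

text \<open>\<open>comp E m n d\<close> is the degree \<open>d\<close> part of \<open>E(m,n)\<close>. The group \<open>S_n\<close> consists of the
  permutations of \<open>{..<n}\<close>.\<close>

record ('k, 'e) sbimod =
  comp :: "nat \<Rightarrow> nat \<Rightarrow> int \<Rightarrow> 'e set"
  scal :: "'k \<Rightarrow> 'e \<Rightarrow> 'e"
  lact :: "(nat \<Rightarrow> nat) \<Rightarrow> 'e \<Rightarrow> 'e"
  ract :: "(nat \<Rightarrow> nat) \<Rightarrow> 'e \<Rightarrow> 'e"

locale graded_S_bimodule =
  fixes E :: "('k::field, 'e::ab_group_add) sbimod"
  assumes vs: "vector_space (scal E)"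
    and subsp: "module.subspace (scal E) (comp E m n d)"
    and lact_closed: "\<sigma> permutes {..<m} \<Longrightarrow> x \<in> comp E m n d \<Longrightarrow> lact E \<sigma> x \<in> comp E m n d"
    and ract_closed: "\<tau> permutes {..<n} \<Longrightarrow> x \<in> comp E m n d \<Longrightarrow> ract E \<tau> x \<in> comp E m n d"
    and lact_lin: "\<sigma> permutes {..<m} \<Longrightarrow> x \<in> comp E m n d \<Longrightarrow> y \<in> comp E m n d \<Longrightarrow>
       lact E \<sigma> (scal E a x + scal E b y) = scal E a (lact E \<sigma> x) + scal E b (lact E \<sigma> y)"
    and ract_lin: "\<tau> permutes {..<n} \<Longrightarrow> x \<in> comp E m n d \<Longrightarrow> y \<in> comp E m n d \<Longrightarrow>
       ract E \<tau> (scal E a x + scal E b y) = scal E a (ract E \<tau> x) + scal E b (ract E \<tau> y)"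
    and lact_id: "x \<in> comp E m n d \<Longrightarrow> lact E id x = x"
    and ract_id: "x \<in> comp E m n d \<Longrightarrow> ract E id x = x"
    and lact_comp: "\<sigma> permutes {..<m} \<Longrightarrow> \<sigma>' permutes {..<m} \<Longrightarrow> x \<in> comp E m n d \<Longrightarrow>
       lact E (\<sigma> \<circ> \<sigma>') x = lact E \<sigma> (lact E \<sigma>' x)"
    and ract_comp: "\<tau> permutes {..<n} \<Longrightarrow> \<tau>' permutes {..<n} \<Longrightarrow> x \<in> comp E m n d \<Longrightarrow>
       ract E (\<tau> \<circ> \<tau>') x = ract E \<tau>' (ract E \<tau> x)"
    and acts_commute: "\<sigma> permutes {..<m} \<Longrightarrow> \<tau> permutes {..<n} \<Longrightarrow> x \<in> comp E m n d \<Longrightarrow>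
       lact E \<sigma> (ract E \<tau> x) = ract E \<tau> (lact E \<sigma> x)"


section \<open>Decorated directed graphs\<close>

text \<open>Edges are natural numbers. A vertex carries a decoration of degree \<open>vdeg\<close> together with
  the lists of its outgoing and incoming edges, the \<open>j\<close>-th edge being attached to the \<open>j\<close>-th
  output or input of the decoration. The lists \<open>gout\<close> and \<open>gin\<close> are the labelled output and
  input legs. Every edge starts at exactly one place (an output of a vertex or an input leg)
  and ends at exactly one place (an input of a vertex or an output leg). An edge may be both an
  input and an output leg (the unit of a prop), but there are no circles without vertices.
  The vertices are listed in the order in which their decorations are tensored.\<close>

record 'e vertex =
  vdeg :: int
  vdec :: 'e
  vout :: "nat list"
  vin :: "nat list"

record 'e dgraph =
  verts :: "'e vertex list"
  gout :: "nat list"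
  gin :: "nat list"

definition starts :: "'e dgraph \<Rightarrow> nat list" where
  "starts G = gin G @ concat (map vout (verts G))"

definition ends :: "'e dgraph \<Rightarrow> nat list" where
  "ends G = gout G @ concat (map vin (verts G))"

definition wf_dgraph :: "'e dgraph \<Rightarrow> bool" where
  "wf_dgraph G \<longleftrightarrow> distinct (starts G) \<and> distinct (ends G) \<and> set (starts G) = set (ends G)"

definition arcs :: "'e dgraph \<Rightarrow> (nat \<times> nat) set" where
  "arcs G = {(i, j). i < length (verts G) \<and> j < length (verts G) \<and>
     set (vout (verts G ! i)) \<inter> set (vin (verts G ! j)) \<noteq> {}}"

definition cyclic_edges :: "'e dgraph \<Rightarrow> nat set" where
  "cyclic_edges G = {e. \<exists>i j. i < length (verts G) \<and> j < length (verts G) \<and>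
     e \<in> set (vout (verts G ! i)) \<and> e \<in> set (vin (verts G ! j)) \<and> (j, i) \<in> (arcs G)\<^sup>*}"

definition dgraphs :: "('k, 'e) sbimod \<Rightarrow> nat \<Rightarrow> nat \<Rightarrow> int \<Rightarrow> 'e dgraph set" where
  "dgraphs E m n d = {G. wf_dgraph G \<and> length (gout G) = m \<and> length (gin G) = n \<and>
     (\<forall>v\<in>set (verts G). vdec v \<in> comp E (length (vout v)) (length (vin v)) (vdeg v)) \<and>
     sum_list (map vdeg (verts G)) = d}"

definition dgraphs_up :: "('k, 'e) sbimod \<Rightarrow> nat \<Rightarrow> nat \<Rightarrow> int \<Rightarrow> 'e dgraph set" where
  "dgraphs_up E m n d = {G \<in> dgraphs E m n d. acyclic (arcs G)}"

definition map_vertex :: "(nat \<Rightarrow> nat) \<Rightarrow> (nat \<Rightarrow> nat) \<Rightarrow> 'e vertex \<Rightarrow> 'e vertex" where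
  "map_vertex f g v = v\<lparr>vout := map f (vout v), vin := map g (vin v)\<rparr>"

definition rename :: "(nat \<Rightarrow> nat) \<Rightarrow> 'e dgraph \<Rightarrow> 'e dgraph" where
  "rename f G = \<lparr>verts = map (map_vertex f f) (verts G), gout = map f (gout G), gin = map f (gin G)\<rparr>"

definition upd_vertex :: "'e dgraph \<Rightarrow> nat \<Rightarrow> 'e vertex \<Rightarrow> 'e dgraph" where
  "upd_vertex G i v = G\<lparr>verts := (verts G)[i := v]\<rparr>"

text \<open>The relations that present the direct sum of the spaces \<open>G\<langle>E\<rangle>\<close>, taken over isomorphism
  classes of graphs \<open>G\<close>, as a quotient of the free vector space on a class \<open>\<G>\<close> of decorated
  graphs: multilinearity in the decorations, compatibility of the actions on \<open>E(m,n)\<close> with the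
  attachment of edges, the Koszul sign rule for reordering the tensor factors, and invariance
  under renaming of edges.\<close>

inductive_set graph_rels ::
    "('k::field, 'e::ab_group_add) sbimod \<Rightarrow> 'e dgraph set \<Rightarrow> ('e dgraph \<Rightarrow>\<^sub>0 'k) set"
  for E :: "('k, 'e) sbimod" and \<G> :: "'e dgraph set" where
  multilinear: "\<lbrakk>G \<in> \<G>; i < length (verts G); v = verts G ! i;
     x \<in> comp E (length (vout v)) (length (vin v)) (vdeg v);
     y \<in> comp E (length (vout v)) (length (vin v)) (vdeg v)\<rbrakk> \<Longrightarrow>
     basis (upd_vertex G i (v\<lparr>vdec := scal E a x + scal E b y\<rparr>))
     - pscale a (basis (upd_vertex G i (v\<lparr>vdec := x\<rparr>)))
     - pscale b (basis (upd_vertex G i (v\<lparr>vdec := y\<rparr>))) \<in> graph_rels E \<G>"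
| equivariant: "\<lbrakk>G \<in> \<G>; i < length (verts G); v = verts G ! i;
     \<sigma> permutes {..<length (vout v)}; \<tau> permutes {..<length (vin v)}\<rbrakk> \<Longrightarrow>
     basis (upd_vertex G i (v\<lparr>vdec := lact E \<sigma> (ract E \<tau> (vdec v)),
       vout := permute_list (inv \<sigma>) (vout v), vin := permute_list \<tau> (vin v)\<rparr>))
     - basis G \<in> graph_rels E \<G>"
| reorder: "\<lbrakk>G \<in> \<G>; Suc i < length (verts G); v = verts G ! i; w = verts G ! Suc i\<rbrakk> \<Longrightarrow>
     basis (upd_vertex (upd_vertex G i w) (Suc i) v)
     - pscale (ksign (vdeg v * vdeg w)) (basis G) \<in> graph_rels E \<G>"
| relabel: "\<lbrakk>G \<in> \<G>; inj_on f (set (starts G))\<rbrakk> \<Longrightarrow>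
     basis (rename f G) - basis G \<in> graph_rels E \<G>"


section \<open>Vertex-by-vertex differentials\<close>

definition redirect :: "nat list \<Rightarrow> nat list \<Rightarrow> (nat \<Rightarrow> nat) \<Rightarrow> nat \<Rightarrow> nat" where
  "redirect xs ys f e = (case map_of (zip xs ys) e of Some e' \<Rightarrow> e' | None \<Rightarrow> f e)"

text \<open>\<open>graft G i H\<close> replaces the \<open>i\<close>-th vertex of \<open>G\<close> by \<open>H\<close>, whose legs are glued to the edges
  at that vertex. It is meant for graphs \<open>H\<close> in which no edge is both an input and an output
  leg. Edges of \<open>G\<close> become even numbers, internal edges of \<open>H\<close> odd ones.\<close>

definition graft :: "'e dgraph \<Rightarrow> nat \<Rightarrow> 'e dgraph \<Rightarrow> 'e dgraph" where
  "graft G i H = (let v = verts G ! i; old = (\<lambda>e. 2 * e); new = (\<lambda>e. 2 * e + 1) in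
     \<lparr>verts = map (map_vertex old old) (take i (verts G))
        @ map (map_vertex (redirect (gout H) (map old (vout v)) new)
                          (redirect (gin H) (map old (vin v)) new)) (verts H)
        @ map (map_vertex old old) (drop (Suc i) (verts G)),
      gout = map old (gout G), gin = map old (gin G)\<rparr>)"

text \<open>\<open>\<delta> m n e\<close> is (a representative of) the value of the differential on the corolla decorated
  by \<open>e\<close> in \<open>E(m,n)\<close>.\<close>

definition graph_diff ::
    "(nat \<Rightarrow> nat \<Rightarrow> 'e \<Rightarrow> ('e dgraph \<Rightarrow>\<^sub>0 'k::field)) \<Rightarrow> ('e dgraph \<Rightarrow>\<^sub>0 'k) \<Rightarrow> ('e dgraph \<Rightarrow>\<^sub>0 'k)" where
  "graph_diff \<delta> = lin (\<lambda>G. \<Sum>i<length (verts G).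
     pscale (ksign (\<Sum>j<i. vdeg (verts G ! j)))
       (lin (\<lambda>H. basis (graft G i H))
         (\<delta> (length (vout (verts G ! i))) (length (vin (verts G ! i))) (vdec (verts G ! i)))))"

text \<open>The \<open>(m,n)\<close>-component of the wheeled completion of the quasi-free prop on \<open>E\<close>.\<close>

definition free_wheeled ::
    "('k::field, 'e::ab_group_add) sbimod \<Rightarrow> (nat \<Rightarrow> nat \<Rightarrow> 'e \<Rightarrow> ('e dgraph \<Rightarrow>\<^sub>0 'k)) \<Rightarrow>
     nat \<Rightarrow> nat \<Rightarrow> ('e dgraph \<Rightarrow>\<^sub>0 'k) cochain_complex" where
  "free_wheeled E \<delta> m n =
     \<lparr>chains = (\<lambda>i. free_on (dgraphs E m n i)),
      rels = (\<lambda>i. free_vs.span (graph_rels E (dgraphs E m n i))),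
      diff = graph_diff \<delta>\<rparr>"


section \<open>Prop ideals and wheeled completions\<close>

definition hcomp :: "'e dgraph \<Rightarrow> 'e dgraph \<Rightarrow> 'e dgraph" where
  "hcomp G H = (let G' = rename (\<lambda>e. 2 * e + 1) G; H' = rename (\<lambda>e. 2 * e) H in
     \<lparr>verts = verts G' @ verts H', gout = gout G' @ gout H', gin = gin G' @ gin H'\<rparr>)"

text \<open>\<open>vcomp G H\<close> glues the input legs of \<open>G\<close> to the output legs of \<open>H\<close>.\<close>

definition vcomp :: "'e dgraph \<Rightarrow> 'e dgraph \<Rightarrow> 'e dgraph" where
  "vcomp G H = (let H' = rename (\<lambda>e. 2 * e) H;
       G' = rename (redirect (gin G) (gout H') (\<lambda>e. 2 * e + 1)) G in
     \<lparr>verts = verts G' @ verts H', gout = gout G', gin = gin H'\<rparr>)"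

text \<open>The ideal of the free prop on \<open>E\<close> generated by \<open>I\<close>, as a family of subspaces of the free
  vector spaces on decorated wheel-free graphs which contain all graph relations. Closure
  under the symmetric group actions is composition with graphs without vertices.\<close>

inductive prop_ideal ::
    "('k::field, 'e::ab_group_add) sbimod \<Rightarrow> (nat \<Rightarrow> nat \<Rightarrow> int \<Rightarrow> ('e dgraph \<Rightarrow>\<^sub>0 'k) set) \<Rightarrow>
     nat \<Rightarrow> nat \<Rightarrow> int \<Rightarrow> ('e dgraph \<Rightarrow>\<^sub>0 'k) \<Rightarrow> bool"
  for E :: "('k, 'e) sbimod" and I :: "nat \<Rightarrow> nat \<Rightarrow> int \<Rightarrow> ('e dgraph \<Rightarrow>\<^sub>0 'k) set" where
  gen: "x \<in> I m n d \<Longrightarrow> prop_ideal E I m n d x"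
| rel: "x \<in> graph_rels E (dgraphs_up E m n d) \<Longrightarrow> prop_ideal E I m n d x"
| zero: "prop_ideal E I m n d 0"
| add: "prop_ideal E I m n d x \<Longrightarrow> prop_ideal E I m n d y \<Longrightarrow> prop_ideal E I m n d (x + y)"
| scale: "prop_ideal E I m n d x \<Longrightarrow> prop_ideal E I m n d (pscale c x)"
| hcomp_right: "prop_ideal E I m n d x \<Longrightarrow> H \<in> dgraphs_up E m' n' d' \<Longrightarrow>
    prop_ideal E I (m + m') (n + n') (d + d') (lin (\<lambda>G. basis (hcomp G H)) x)"
| hcomp_left: "prop_ideal E I m n d x \<Longrightarrow> H \<in> dgraphs_up E m' n' d' \<Longrightarrow>
    prop_ideal E I (m' + m) (n' + n) (d' + d) (lin (\<lambda>G. basis (hcomp H G)) x)"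
| vcomp_right: "prop_ideal E I m n d x \<Longrightarrow> H \<in> dgraphs_up E n p d' \<Longrightarrow>
    prop_ideal E I m p (d + d') (lin (\<lambda>G. basis (vcomp G H)) x)"
| vcomp_left: "prop_ideal E I m n d x \<Longrightarrow> H \<in> dgraphs_up E p m d' \<Longrightarrow>
    prop_ideal E I p n (d' + d) (lin (\<lambda>G. basis (vcomp H G)) x)"

text \<open>Breaking the edges in the list \<open>es\<close>: the \<open>j\<close>-th of them is cut into an output leg and an
  input leg, which become the \<open>j\<close>-th new output and input legs.\<close>

definition break_edges :: "'e dgraph \<Rightarrow> nat list \<Rightarrow> 'e dgraph" where
  "break_edges G es =
     \<lparr>verts = map (map_vertex (\<lambda>e. 2 * e) (\<lambda>e. if e \<in> set es then 2 * e + 1 else 2 * e)) (verts G),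
      gout = map (\<lambda>e. 2 * e) (gout G @ es),
      gin = map (\<lambda>e. 2 * e) (gin G) @ map (\<lambda>e. 2 * e + 1) es\<rparr>"

text \<open>An element of the free wheeled space is a linear combination of decorated graphs; in each
  of its graphs a set of \<open>k\<close> cyclic edges is broken, the edges being listed so that the new legs
  of the various graphs are labelled consistently.\<close>

definition wheeled_ideal_gens ::
    "('k::field, 'e::ab_group_add) sbimod \<Rightarrow> (nat \<Rightarrow> nat \<Rightarrow> int \<Rightarrow> ('e dgraph \<Rightarrow>\<^sub>0 'k) set) \<Rightarrow>
     nat \<Rightarrow> nat \<Rightarrow> int \<Rightarrow> ('e dgraph \<Rightarrow>\<^sub>0 'k) set" where
  "wheeled_ideal_gens E I m n d = {x \<in> free_on (dgraphs E m n d). \<exists>k es.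
     (\<forall>G\<in>Poly_Mapping.keys x.
        length (es G) = k \<and> distinct (es G) \<and> set (es G) \<subseteq> cyclic_edges G) \<and>
     prop_ideal E I (m + k) (n + k) d (lin (\<lambda>G. basis (break_edges G (es G))) x)}"

text \<open>The \<open>(m,n)\<close>-component of the wheeled completion of the (di)operad presented by generators
  \<open>E\<close> and relations \<open>I\<close>, with zero differential.\<close>

definition wheeled_completion ::
    "('k::field, 'e::ab_group_add) sbimod \<Rightarrow> (nat \<Rightarrow> nat \<Rightarrow> int \<Rightarrow> ('e dgraph \<Rightarrow>\<^sub>0 'k) set) \<Rightarrow>
     nat \<Rightarrow> nat \<Rightarrow> ('e dgraph \<Rightarrow>\<^sub>0 'k) cochain_complex" where
  "wheeled_completion E I m n =
     \<lparr>chains = (\<lambda>i. free_on (dgraphs E m n i)),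
      rels = (\<lambda>i. free_vs.span
        (graph_rels E (dgraphs E m n i) \<union> wheeled_ideal_gens E I m n i)),
      diff = (\<lambda>_. 0)\<rparr>"

text \<open>The map on decorated graphs induced by a morphism \<open>p\<close> of S-bimodules.\<close>

definition map_dec :: "(nat \<Rightarrow> nat \<Rightarrow> 'e \<Rightarrow> 'f) \<Rightarrow> 'e dgraph \<Rightarrow> 'f dgraph" where
  "map_dec p G = \<lparr>verts = map (\<lambda>v. \<lparr>vdeg = vdeg v,
       vdec = p (length (vout v)) (length (vin v)) (vdec v), vout = vout v, vin = vin v\<rparr>) (verts G),
     gout = gout G, gin = gin G\<rparr>"

definition graph_map ::
    "(nat \<Rightarrow> nat \<Rightarrow> 'e \<Rightarrow> 'f) \<Rightarrow> ('e dgraph \<Rightarrow>\<^sub>0 'k::field) \<Rightarrow> ('f dgraph \<Rightarrow>\<^sub>0 'k)" where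
  "graph_map p = lin (\<lambda>G. basis (map_dec p G))"

text \<open>For a Koszul (di)operad presented by \<open>E'\<close> and \<open>I\<close>, whose minimal resolution is quasi-free
  on \<open>E\<close> with differential \<open>\<delta>\<close> and maps onto it by \<open>p : E \<rightarrow> E'\<close> on generators.\<close>

definition stably_Koszul ::
    "('k::field, 'e::ab_group_add) sbimod \<Rightarrow> (nat \<Rightarrow> nat \<Rightarrow> 'e \<Rightarrow> ('e dgraph \<Rightarrow>\<^sub>0 'k)) \<Rightarrow>
     (nat \<Rightarrow> nat \<Rightarrow> 'e \<Rightarrow> 'f) \<Rightarrow>
     ('k, 'f::ab_group_add) sbimod \<Rightarrow> (nat \<Rightarrow> nat \<Rightarrow> int \<Rightarrow> ('f dgraph \<Rightarrow>\<^sub>0 'k) set) \<Rightarrow> bool" where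
  "stably_Koszul E \<delta> p E' I \<longleftrightarrow>
     (\<forall>m n. quasi_isomorphism (graph_map p) (free_wheeled E \<delta> m n) (wheeled_completion E' I m n))"


section \<open>The operad Ass and its minimal resolution\<close>

text \<open>The S-bimodule with \<open>E(1,n) = K[S_n]\<close>, placed in degree \<open>2 - n\<close>, for \<open>n\<close> in \<open>A\<close>, and zero
  otherwise; \<open>S_n\<close> acts by right multiplication. The basis element \<open>id\<close> is the \<open>n\<close>-ary operation.\<close>

type_synonym 'k planar = "(nat \<Rightarrow> nat) \<Rightarrow>\<^sub>0 'k"

definition planar_gens :: "nat set \<Rightarrow> ('k::field, 'k planar) sbimod" where
  "planar_gens A =
     \<lparr>comp = (\<lambda>m n d. if m = 1 \<and> n \<in> A \<and> d = 2 - int n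
                then free_on {\<rho>. \<rho> permutes {..<n}} else {0}),
      scal = pscale,
      lact = (\<lambda>\<sigma> x. x),
      ract = (\<lambda>\<tau>. lin (\<lambda>\<rho>. basis (\<rho> \<circ> \<tau>)))\<rparr>"

lemma planar_gens_graded_S_bimodule:
  "graded_S_bimodule (planar_gens A :: ('k::field, 'k planar) sbimod)"
proof -
  have cl: "lin (\<lambda>\<rho>. basis (\<rho> \<circ> \<tau>)) x \<in> free_on {\<rho>. \<rho> permutes {..<n}}"
    if "\<tau> permutes {..<n}" "x \<in> free_on {\<rho>. \<rho> permutes {..<n}}"
    for \<tau> n and x :: "'k planar"
    using that by (intro lin_free_on[OF _ that(2)]) (auto simp: free_on_def basis_def permutes_compose)
  have sc: "scal (planar_gens A) = (pscale :: 'k \<Rightarrow> 'k planar \<Rightarrow> 'k planar)"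
    and la: "lact (planar_gens A) \<sigma> x = x"
    and ra: "ract (planar_gens A) \<tau> x = lin (\<lambda>\<rho>. basis (\<rho> \<circ> \<tau>)) x"
    and co: "comp (planar_gens A) m n d = (if m = 1 \<and> n \<in> A \<and> d = 2 - int n
                then free_on {\<rho>. \<rho> permutes {..<n}} else {0})" for \<sigma> \<tau> m n d and x :: "'k planar"
    by (simp_all add: planar_gens_def)
  have sub: "free_vs.subspace (comp (planar_gens A) m n d)" for m n d
    by (simp add: co subspace_free_on)
  show ?thesis
    by (rule graded_S_bimodule.intro; (unfold sc)?)
       (simp_all add: sub free_vs.vector_space_axioms la ra lin_add lin_pscale lin_lin lin_id_on
          comp_assoc, auto simp: co cl split: if_splits)
qed

text \<open>The two-vertex tree on \<open>n\<close> inputs in which the \<open>l\<close>-ary operation, applied to the inputs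
  numbered \<open>k, \<dots>, k + l - 1\<close>, is inserted into the \<open>(n - l + 1)\<close>-ary one. The right action of
  \<open>\<rho>\<close> on it permutes the input legs. Edges \<open>0, \<dots>, n - 1\<close> are the inputs, \<open>n\<close> is internal,
  \<open>n + 1\<close> is the output.\<close>

definition tree2 :: "nat \<Rightarrow> nat \<Rightarrow> nat \<Rightarrow> (nat \<Rightarrow> nat) \<Rightarrow> ('k::field planar) dgraph" where
  "tree2 n k l \<rho> =
     \<lparr>verts = [\<lparr>vdeg = 1 + int l - int n, vdec = basis id, vout = [n + 1],
                 vin = [0..<k] @ [n] @ [k + l..<n]\<rparr>,
               \<lparr>vdeg = 2 - int l, vdec = basis id, vout = [n], vin = [k..<k + l]\<rparr>],
      gout = [n + 1], gin = permute_list \<rho> [0..<n]\<rparr>"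

definition Ass_gens :: "('k::field, 'k planar) sbimod" where
  "Ass_gens = planar_gens {2}"

definition Ass_rels :: "nat \<Rightarrow> nat \<Rightarrow> int \<Rightarrow> ('k::field planar dgraph \<Rightarrow>\<^sub>0 'k) set" where
  "Ass_rels m n d = (if m = 1 \<and> n = 3 \<and> d = 0
     then {basis (tree2 3 0 2 id) - basis (tree2 3 1 2 id)} else {})"

definition Ass_inf_gens :: "('k::field, 'k planar) sbimod" where
  "Ass_inf_gens = planar_gens {2..}"

definition Ass_inf_diff :: "nat \<Rightarrow> nat \<Rightarrow> 'k::field planar \<Rightarrow> ('k planar dgraph \<Rightarrow>\<^sub>0 'k)" where
  "Ass_inf_diff m n = lin (\<lambda>\<rho>. \<Sum>(k, l)\<in>{(k, l). 2 \<le> l \<and> l < n \<and> k + l \<le> n}.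
     pscale (ksign (int k + int l * (int n - int k - int l) + 1)) (basis (tree2 n k l \<rho>)))"

definition Ass_inf_proj :: "nat \<Rightarrow> nat \<Rightarrow> 'k::field planar \<Rightarrow> 'k planar" where
  "Ass_inf_proj m n x = (if n = 2 then x else 0)"

end

theory Submission
  imports Defs
begin

text \<open>Closing the middle input of the ternary operation of \<open>Ass\<^sub>\<infinity>\<close> into a loop gives an element
  of degree \<open>- 1\<close> in the \<open>(0,2)\<close>-component. The two summands of its boundary are the traces of
  \<open>R\<^sub>y L\<^sub>x\<close> and \<open>L\<^sub>x R\<^sub>y\<close>, where \<open>L\<^sub>x\<close> and \<open>R\<^sub>y\<close> are left and right multiplications, and they
  cancel by cyclic symmetry of the trace. Every graph in a boundary has at least two vertices,
  so this one-vertex cocycle is not exact, but it dies in the wheeled completion of \<open>Ass\<close>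
  because the ternary operation does.\<close>

section \<open>Linear extension, permuted lists and cosets of coboundaries\<close>

lemma lin_cong:
  "x = y \<Longrightarrow> (\<And>a. a \<in> Poly_Mapping.keys y \<Longrightarrow> f a = g a) \<Longrightarrow> lin f x = lin g y"
  unfolding lin_def by (rule sum.cong) auto

lemma lin_diff: "lin f (x - y) = lin f x - lin f y"
  using lin_add[of f "x - y" y] by (simp add: algebra_simps)

lemma lin_zero_fun: "(\<And>a. a \<in> Poly_Mapping.keys x \<Longrightarrow> f a = 0) \<Longrightarrow> lin f x = 0"
  by (simp add: lin_def)

lemma lin_vanishes_on_span:
  assumes "\<And>x. x \<in> S \<Longrightarrow> lin f x = 0" "x \<in> free_vs.span S"
  shows "lin f x = 0"
  using assms(2)
  by (induction rule: free_vs.span_induct_alt) (simp_all add: lin_add lin_pscale assms(1))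

lemma permute_list_cancel:
  assumes "\<tau> permutes {..<length xs}" "length ys = length xs"
  shows "permute_list \<tau> xs = permute_list \<tau> ys \<longleftrightarrow> xs = ys"
proof -
  have "permute_list (inv \<tau>) (permute_list \<tau> zs) = zs" if "length zs = length xs" for zs :: "'a list"
    using that permutes_inv[OF assms(1)] permutes_inv_o(1)[OF assms(1)]
    by (metis permute_list_compose permute_list_id)
  then show ?thesis
    using assms(2) by metis
qed

text \<open>With \<open>a = b = 0\<close> and \<open>x = y = 0\<close>, the multilinearity relation
  at \<open>v\<close> reduces to the graph itself.\<close>

lemma zero_decoration_in_rels:
  assumes "G \<in> \<G>" "v \<in> set (verts G)" "vdec v = 0"
    and "0 \<in> comp E (length (vout v)) (length (vin v)) (vdeg v)" "vector_space (scal E)"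
  shows "basis G \<in> graph_rels E \<G>"
proof -
  interpret vector_space "scal E" by fact
  obtain i where i: "i < length (verts G)" "verts G ! i = v"
    using assms(2) by (auto simp: in_set_conv_nth)
  have "upd_vertex G i (v\<lparr>vdec := 0\<rparr>) = G"
    using i assms(3) list_update_id[of "verts G" i] by (cases v, cases G) (simp add: upd_vertex_def)
  then show ?thesis
    using graph_rels.multilinear[of G \<G> i v 0 E 0 0 0] assms i
    by simp
qed

text \<open>Since \<open>B\<close> is a subgroup containing \<open>f z\<close>, translation by
  \<open>f z\<close> fixes each of its cosets. With \<open>X\<close> the zero class, the class of
  \<open>z\<close> has the same image as zero.\<close>

lemma cohomology_map_translate:
  assumes "\<And>x y. f (x + y) = f x + f y"
    and "f z \<in> B" "coboundaries D i = B" "\<And>x y. x \<in> B \<Longrightarrow> y \<in> B \<Longrightarrow> x + y \<in> B \<and> - x \<in> B"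
  shows "cohomology_map f D i ((+) z ` X) = cohomology_map f D i X"
proof -
  have "(+) (f z) ` B = B"
  proof (intro equalityI subsetI)
    fix b assume "b \<in> B"
    then have "- f z + b \<in> B" using assms(2,4) by blast
    moreover have "b = f z + (- f z + b)" by simp
    ultimately show "b \<in> (+) (f z) ` B" by blast
  qed (use assms in auto)
  moreover have "(+) (f (z + x)) ` B = (+) (f x) ` (+) (f z) ` B" for x
    unfolding image_image assms(1) by (simp add: ac_simps)
  ultimately show ?thesis
    by (simp add: cohomology_map_def assms(3) image_image)
qed

lemma planar_comp_0: "0 \<in> comp (planar_gens A) m n d"
  by (simp add: planar_gens_def free_on_def)

lemma planar_vs: "vector_space (scal (planar_gens A))"
  using graded_S_bimodule.vs[OF planar_gens_graded_S_bimodule] .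

text \<open>Edge \<open>0\<close> is the loop; edges \<open>1\<close> and \<open>2\<close> are the
  legs x and y to its left and right.\<close>

definition middle_loop :: "('k::field planar) dgraph" where
  "middle_loop =
     \<lparr>verts = [\<lparr>vdeg = - 1, vdec = basis id, vout = [0], vin = [1, 0, 2]\<rparr>],
      gout = [], gin = [1, 2]\<rparr>"

section \<open>A functional that detects the loop\<close>

text \<open>On graphs with one vertex, the coefficient of \<^const>\<open>middle_loop\<close>, encoded as an element of
  the free vector space on one generator so that it extends to a functional by \<^const>\<open>lin\<close>.\<close>

definition middle_loop_coeff :: "('k::field planar) dgraph \<Rightarrow> (unit \<Rightarrow>\<^sub>0 'k)" where
  "middle_loop_coeff G = (case verts G of
     [v] \<Rightarrow> lin (\<lambda>\<rho>. if vin v = permute_list \<rho> [gin G ! 0, hd (vout v), gin G ! 1]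
                    then basis () else 0) (vdec v)
   | _ \<Rightarrow> 0)"

lemma middle_loop_coeff_middle_loop: "middle_loop_coeff middle_loop = basis ()"
  by (simp add: middle_loop_coeff_def middle_loop_def)

lemma middle_loop_coeff_not_single: "length (verts G) \<noteq> 1 \<Longrightarrow> middle_loop_coeff G = 0"
  by (auto simp: middle_loop_coeff_def split: list.split)

text \<open>An \<open>n\<close>-ary generator has degree \<open>2 - n\<close>, so degree
  \<open>- 1\<close> forces \<open>n = 3\<close>; only the zero decoration, which lies in every
  component, escapes this.\<close>

lemma single_vertex_cases:
  assumes "G \<in> dgraphs Ass_inf_gens 0 2 (- 1)" "verts G = [v]"
  obtains "vdec v = 0"
  | "length (vout v) = 1" "length (vin v) = 3"
    "\<And>\<rho>. \<rho> \<in> Poly_Mapping.keys (vdec v) \<Longrightarrow> \<rho> permutes {..<3}"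
proof -
  have "vdeg v = - 1" "vdec v \<in> comp Ass_inf_gens (length (vout v)) (length (vin v)) (vdeg v)"
    using assms by (auto simp: dgraphs_def)
  then have "vdec v = 0 \<or> length (vout v) = 1 \<and> length (vin v) = 3 \<and>
      vdec v \<in> free_on {\<rho>. \<rho> permutes {..<3}}"
    by (auto simp: Ass_inf_gens_def planar_gens_def split: if_splits)
  then show thesis
    using that by (auto simp: free_on_def)
qed

text \<open>Edge names enter only through an equality test between two lists, and \<open>f\<close>
  is injective on the edges in both.\<close>

lemma middle_loop_coeff_rename:
  assumes G: "G \<in> dgraphs Ass_inf_gens 0 2 (- 1)" and f: "inj_on f (set (starts G))"
  shows "middle_loop_coeff (rename f G) = middle_loop_coeff G"
proof (cases "length (verts G) = 1")
  case True
  then obtain v where v: "verts G = [v]" by (auto simp: length_Suc_conv)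
  from G v show ?thesis
  proof (cases rule: single_vertex_cases)
    case 1
    then show ?thesis
      by (simp add: middle_loop_coeff_def rename_def map_vertex_def v)
  next
    case 2
    let ?L = "[gin G ! 0, hd (vout v), gin G ! 1]"
    have wf: "set (starts G) = set (ends G)" and gin: "length (gin G) = 2"
      using G by (auto simp: dgraphs_def wf_dgraph_def)
    have vout: "vout v = [hd (vout v)]"
      using 2 by (cases "vout v") auto
    have L: "set ?L \<subseteq> set (starts G)"
      using gin vout by (auto simp: starts_def v) (metis list.set_intros(1))
    \<comment> \<open>Inputs of the vertex are ends of edges; well-formedness places them among the
      starts, where \<open>f\<close> is injective.\<close>
    have V: "set (vin v) \<subseteq> set (starts G)"
      by (simp add: wf) (simp add: ends_def v)
    have mapL: "map f ?L = [gin (rename f G) ! 0, hd (map f (vout v)), gin (rename f G) ! 1]"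
      using gin vout by (cases "vout v") (simp_all add: rename_def)
    have "map f (vin v) = permute_list \<rho> (map f ?L) \<longleftrightarrow> vin v = permute_list \<rho> ?L"
      if "\<rho> \<in> Poly_Mapping.keys (vdec v)" for \<rho>
    proof -
      have \<rho>: "\<rho> permutes {..<length ?L}" using 2 that by (simp add: numeral_3_eq_3)
      have "inj_on f (set (vin v) \<union> set (permute_list \<rho> ?L))"
        using L V unfolding set_permute_list[OF \<rho>] by (intro inj_on_subset[OF f]) blast
      then show ?thesis
        unfolding permute_list_map[OF \<rho>] by (rule inj_on_map_eq_map)
    qed
    then show ?thesis
      unfolding middle_loop_coeff_def using v mapL
      by (simp add: rename_def map_vertex_def cong: lin_cong)
  qed
qed (simp add: middle_loop_coeff_not_single rename_def)

text \<open>The right action turns \<rho> into \<open>\<rho> \<circ> \<tau>\<close> in the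
  decoration while \<tau> permutes the inputs, so \<tau> cancels from both sides of the
  test.\<close>

lemma middle_loop_coeff_equivariant:
  assumes G: "G \<in> dgraphs Ass_inf_gens 0 2 (- 1)" and i: "i < length (verts G)"
    and vi: "v = verts G ! i"
    and \<sigma>: "\<sigma> permutes {..<length (vout v)}" and \<tau>: "\<tau> permutes {..<length (vin v)}"
  shows "middle_loop_coeff (upd_vertex G i (v\<lparr>
      vdec := lact Ass_inf_gens \<sigma> (ract Ass_inf_gens \<tau> (vdec v)),
      vout := permute_list (inv \<sigma>) (vout v), vin := permute_list \<tau> (vin v)\<rparr>)) =
    middle_loop_coeff G"
proof (cases "length (verts G) = 1")
  case True
  then have v: "verts G = [v]" and i0: "i = 0"
    using i vi by (auto simp: length_Suc_conv)
  from G v show ?thesis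
  proof (cases rule: single_vertex_cases)
    case 1
    then show ?thesis
      by (simp add: middle_loop_coeff_def upd_vertex_def v i0 Ass_inf_gens_def planar_gens_def)
  next
    case 2
    let ?L = "[gin G ! 0, hd (vout v), gin G ! 1]"
    \<comment> \<open>There is a single output.\<close>
    have "\<sigma> = id" using \<sigma> 2 by (simp add: lessThan_Suc permutes_sing)
    moreover have "permute_list \<tau> (vin v) = permute_list (\<rho> \<circ> \<tau>) ?L \<longleftrightarrow> vin v = permute_list \<rho> ?L"
      for \<rho>
      using \<tau> 2 permute_list_cancel[OF \<tau>, of "permute_list \<rho> ?L"]
        permute_list_compose[of \<tau> ?L \<rho>] by (simp add: numeral_3_eq_3)
    ultimately show ?thesis
      by (simp add: middle_loop_coeff_def upd_vertex_def v i0 Ass_inf_gens_def planar_gens_def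
          lin_lin)
  qed
qed (simp add: middle_loop_coeff_not_single upd_vertex_def)

lemma middle_loop_coeff_multilinear:
  assumes "i < length (verts G)"
  shows "middle_loop_coeff (upd_vertex G i (v\<lparr>vdec := pscale a x + pscale b y\<rparr>)) =
    pscale a (middle_loop_coeff (upd_vertex G i (v\<lparr>vdec := x\<rparr>))) +
    pscale b (middle_loop_coeff (upd_vertex G i (v\<lparr>vdec := y\<rparr>)))"
proof (cases "length (verts G) = 1")
  case True
  then show ?thesis using assms
    by (auto simp: length_Suc_conv middle_loop_coeff_def upd_vertex_def lin_add lin_pscale)
qed (simp add: middle_loop_coeff_not_single upd_vertex_def)

text \<open>This lets the functional descend to the quotient by the graph relations.\<close>

lemma middle_loop_coeff_rels:
  assumes "x \<in> graph_rels (Ass_inf_gens :: ('k::field, 'k planar) sbimod)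
      (dgraphs Ass_inf_gens 0 2 (- 1))"
  shows "lin middle_loop_coeff x = 0"
  using assms
proof (cases rule: graph_rels.cases)
  case (multilinear G i v x y a b)
  have "scal Ass_inf_gens = (pscale :: 'k \<Rightarrow> _)"
    by (simp add: Ass_inf_gens_def planar_gens_def)
  then show ?thesis
    using multilinear by (simp add: lin_diff lin_pscale middle_loop_coeff_multilinear)
next
  case (equivariant G i v \<sigma> \<tau>)
  then show ?thesis by (simp add: lin_diff middle_loop_coeff_equivariant)
next
  case (reorder G i v w)
  \<comment> \<open>Reordering involves at least two vertices, where the coefficient is
    zero.\<close>
  then show ?thesis
    by (simp add: lin_diff lin_pscale middle_loop_coeff_not_single upd_vertex_def)
next
  case (relabel G f)
  then show ?thesis by (simp add: lin_diff middle_loop_coeff_rename)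
qed

text \<open>Grafting replaces one vertex by a tree with two, so no one-vertex graph results.\<close>

lemma middle_loop_coeff_boundary:
  "lin middle_loop_coeff (graph_diff Ass_inf_diff (y :: _ \<Rightarrow>\<^sub>0 'k::field)) = 0"
proof -
  have "lin (\<lambda>H. middle_loop_coeff (graft G i H)) (Ass_inf_diff m n e) = 0"
    if "i < length (verts G)" for G :: "'k planar dgraph" and i m n e
  proof -
    have fin: "finite {(k, l). 2 \<le> l \<and> l < n \<and> k + l \<le> n}"
      by (rule finite_subset[of _ "{..n} \<times> {..n}"]) auto
    have "middle_loop_coeff (graft G i (tree2 n k l \<rho>)) = 0" for k l \<rho>
      using that by (intro middle_loop_coeff_not_single) (auto simp: graft_def tree2_def Let_def)
    then show ?thesis
      unfolding Ass_inf_diff_def lin_lin lin_sum[OF fin]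
      by (intro lin_zero_fun sum.neutral) (auto simp: lin_pscale)
  qed
  then show ?thesis
    unfolding graph_diff_def lin_lin by (simp add: lin_sum lin_pscale lin_lin lin_zero_fun)
qed

lemma middle_loop_in_dgraphs: "middle_loop \<in> dgraphs Ass_inf_gens 0 2 (- 1)"
  by (simp add: middle_loop_def dgraphs_def wf_dgraph_def starts_def ends_def Ass_inf_gens_def
      planar_gens_def free_on_def basis_def permutes_id insert_commute)

text \<open>The functional kills boundaries and relations but takes the value
  \<open>basis ()\<close> on the loop.\<close>

lemma middle_loop_not_exact:
  "basis middle_loop \<notin> coboundaries
    (free_wheeled (Ass_inf_gens :: ('k::field, 'k planar) sbimod) Ass_inf_diff 0 2) (- 1)"
proof
  assume "basis middle_loop \<in> coboundaries
    (free_wheeled (Ass_inf_gens :: ('k, 'k planar) sbimod) Ass_inf_diff 0 2) (- 1)"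
  then obtain y r :: "'k planar dgraph \<Rightarrow>\<^sub>0 'k" where
    y: "basis middle_loop = graph_diff Ass_inf_diff y + r" and
    r: "r \<in> free_vs.span (graph_rels Ass_inf_gens (dgraphs Ass_inf_gens 0 2 (- 1)))"
    by (auto simp: coboundaries_def free_wheeled_def)
  have "lin middle_loop_coeff (basis middle_loop :: _ \<Rightarrow>\<^sub>0 'k) = 0"
    unfolding y lin_add middle_loop_coeff_boundary
    using lin_vanishes_on_span[OF middle_loop_coeff_rels r] by simp
  then have "(basis () :: _ \<Rightarrow>\<^sub>0 'k) = 0"
    by (simp add: middle_loop_coeff_middle_loop)
  then show False
    using lookup_single_eq[of "()" "1 :: 'k"] by (simp add: basis_def)
qed

section \<open>The boundary of the loop and the cyclicity of the trace\<close>

text \<open>The graphs \<open>tr (R\<^sub>y L\<^sub>x)\<close> and \<open>tr (L\<^sub>x R\<^sub>y)\<close>, with the edge names that \<^const>\<open>graft\<close> produces.\<close>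

definition loop_RL :: "('k::field planar) dgraph" where
  "loop_RL =
     \<lparr>verts = [\<lparr>vdeg = 0, vdec = basis id, vout = [0], vin = [7, 4]\<rparr>,
               \<lparr>vdeg = 0, vdec = basis id, vout = [7], vin = [2, 0]\<rparr>],
      gout = [], gin = [2, 4]\<rparr>"

definition loop_LR :: "('k::field planar) dgraph" where
  "loop_LR =
     \<lparr>verts = [\<lparr>vdeg = 0, vdec = basis id, vout = [0], vin = [2, 7]\<rparr>,
               \<lparr>vdeg = 0, vdec = basis id, vout = [7], vin = [0, 4]\<rparr>],
      gout = [], gin = [2, 4]\<rparr>"

lemma graph_diff_middle_loop:
  "graph_diff Ass_inf_diff (basis middle_loop :: _ \<Rightarrow>\<^sub>0 'k::field) = basis loop_LR - basis loop_RL"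
proof -
  \<comment> \<open>The two index pairs are the bracketings (xy)z and x(yz), with signs - and
    +.\<close>
  have idx: "{(k, l). 2 \<le> l \<and> l < (3::nat) \<and> k + l \<le> 3} = {(0, 2), (1, 2)}"
    by auto
  \<comment> \<open>Old edges \<open>0, 1, 2\<close> become \<open>0, 2, 4\<close>; the internal
    edge \<open>3\<close> of the tree becomes \<open>7\<close>.\<close>
  have "graft middle_loop 0 (tree2 3 0 2 id) = (loop_RL :: 'k planar dgraph)"
    "graft middle_loop 0 (tree2 3 (Suc 0) 2 id) = (loop_LR :: 'k planar dgraph)"
    by (simp_all add: graft_def middle_loop_def tree2_def loop_RL_def loop_LR_def Let_def
        map_vertex_def redirect_def upt_rec)
  moreover have "Ass_inf_diff (Suc 0) 3 (basis id) =
      (basis (tree2 3 (Suc 0) 2 id) - basis (tree2 3 0 2 id) :: _ \<Rightarrow>\<^sub>0 'k)"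
    by (simp add: Ass_inf_diff_def idx ksign_def)
  moreover have "graph_diff Ass_inf_diff (basis middle_loop :: _ \<Rightarrow>\<^sub>0 'k) =
      lin (\<lambda>H. basis (graft middle_loop 0 H)) (Ass_inf_diff (Suc 0) 3 (basis id))"
    by (simp add: graph_diff_def) (simp add: middle_loop_def ksign_def numeral_3_eq_3)
  ultimately show ?thesis by (simp add: lin_diff)
qed

text \<open>Exchanging the two vertices costs no sign, as both have degree \<open>0\<close>;
  swapping the names of the two wheel edges \<open>0\<close> and \<open>7\<close> then gives
  \<open>loop_RL\<close>.\<close>

lemma trace_cyclic:
  "basis loop_LR - basis loop_RL \<in> free_vs.span
    (graph_rels (Ass_inf_gens :: ('k::field, 'k planar) sbimod) (dgraphs Ass_inf_gens 0 2 0))"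
proof -
  let ?\<G> = "dgraphs (Ass_inf_gens :: ('k, 'k planar) sbimod) 0 2 0"
  let ?v = "verts loop_LR ! 0 :: 'k planar vertex" and ?w = "verts loop_LR ! 1 :: 'k planar vertex"
  let ?M = "upd_vertex (upd_vertex loop_LR 0 ?w) (Suc 0) ?v"
  let ?f = "\<lambda>e::nat. if e = 0 then 7 else if e = 7 then 0 else e"
  have LR: "loop_LR \<in> ?\<G>" and M: "?M \<in> ?\<G>"
    by (auto simp: loop_LR_def upd_vertex_def dgraphs_def wf_dgraph_def starts_def ends_def
        Ass_inf_gens_def planar_gens_def free_on_def basis_def permutes_id)
  have "basis ?M - pscale (ksign (vdeg ?v * vdeg ?w)) (basis loop_LR) \<in> graph_rels Ass_inf_gens ?\<G>"
    using graph_rels.reorder[OF LR, of 0 ?v ?w] by (simp add: loop_LR_def)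
  then have reord: "basis ?M - basis loop_LR \<in> graph_rels Ass_inf_gens ?\<G>"
    by (simp add: loop_LR_def ksign_def)
  have "rename ?f ?M = loop_RL"
    by (simp add: loop_LR_def loop_RL_def upd_vertex_def rename_def map_vertex_def)
  moreover have "inj_on ?f (set (starts ?M))"
    by (auto simp: inj_on_def)
  ultimately have relab: "basis loop_RL - basis ?M \<in> graph_rels Ass_inf_gens ?\<G>"
    using graph_rels.relabel[OF M, of ?f] by simp
  have "basis loop_LR - basis loop_RL = - ((basis loop_RL - basis ?M) + (basis ?M - basis loop_LR))"
    by simp
  then show ?thesis
    using reord relab by (metis free_vs.span_neg free_vs.span_add free_vs.span_base)
qed

section \<open>The class of the loop and its image\<close>

lemma middle_loop_cocycle:
  "basis middle_loop \<in> cocycles (free_wheeled Ass_inf_gens Ass_inf_diff 0 2) (- 1)"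
  using middle_loop_in_dgraphs trace_cyclic
  by (simp add: cocycles_def free_wheeled_def graph_diff_middle_loop free_on_def)
     (simp add: basis_def)

text \<open>The projection sends the ternary decoration to \<open>0\<close>, so the image is a graph
  relation.\<close>

lemma middle_loop_dies:
  "graph_map Ass_inf_proj (basis middle_loop) \<in>
    free_vs.span (graph_rels Ass_gens (dgraphs Ass_gens 0 2 (- 1)) \<union> S)"
proof -
  let ?G = "map_dec Ass_inf_proj middle_loop :: 'a planar dgraph"
  have "?G \<in> dgraphs Ass_gens 0 2 (- 1)"
    by (simp add: middle_loop_def map_dec_def Ass_inf_proj_def dgraphs_def wf_dgraph_def
        starts_def ends_def Ass_gens_def planar_comp_0 insert_commute)
  moreover have "\<exists>v\<in>set (verts ?G). vdec v = 0"
    by (simp add: middle_loop_def map_dec_def Ass_inf_proj_def)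
  ultimately have "basis ?G \<in> graph_rels Ass_gens (dgraphs Ass_gens 0 2 (- 1))"
    unfolding Ass_gens_def using zero_decoration_in_rels planar_comp_0 planar_vs by blast
  then show ?thesis
    by (simp add: graph_map_def free_vs.span_base)
qed

theorem claim3p5p4:
  shows "\<not> stably_Koszul (Ass_inf_gens :: ('k::field_char_0, 'k planar) sbimod)
            Ass_inf_diff Ass_inf_proj Ass_gens Ass_rels"
proof
  let ?C = "free_wheeled (Ass_inf_gens :: ('k, 'k planar) sbimod) Ass_inf_diff 0 2"
  let ?D = "wheeled_completion (Ass_gens :: ('k, 'k planar) sbimod) Ass_rels 0 2"
  let ?f = "graph_map Ass_inf_proj :: ('k planar dgraph \<Rightarrow>\<^sub>0 'k) \<Rightarrow> _"
  let ?B = "coboundaries ?C (- 1)"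
  let ?z = "basis middle_loop :: 'k planar dgraph \<Rightarrow>\<^sub>0 'k"
  assume "stably_Koszul (Ass_inf_gens :: ('k, 'k planar) sbimod)
            Ass_inf_diff Ass_inf_proj Ass_gens Ass_rels"
  \<comment> \<open>Injectivity will fail on the class of \<open>?z\<close> and the zero
    class.\<close>
  then have inj: "inj_on (cohomology_map ?f ?D (- 1)) (cohomology ?C (- 1))"
    unfolding stably_Koszul_def quasi_isomorphism_def bij_betw_def by blast
  have "0 \<in> cocycles ?C (- 1)"
    by (simp add: cocycles_def free_wheeled_def free_on_def graph_diff_def free_vs.span_zero)
  then have "(+) 0 ` ?B \<in> cohomology ?C (- 1)"
    unfolding cohomology_def by blast
  then have "?B \<in> cohomology ?C (- 1)"
    by simp
  moreover have "(+) ?z ` ?B \<in> cohomology ?C (- 1)"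
    unfolding cohomology_def using middle_loop_cocycle by blast
  moreover have "cohomology_map ?f ?D (- 1) ((+) ?z ` ?B) = cohomology_map ?f ?D (- 1) ?B"
  proof (rule cohomology_map_translate)
    \<comment> \<open>The target differential is zero, but a coboundary still requires a chain
      \<open>y\<close>; \<open>0\<close> provides one.\<close>
    have "0 \<in> (free_on (dgraphs Ass_gens 0 2 (- 1 - 1)) :: ('k planar dgraph \<Rightarrow>\<^sub>0 'k) set)"
      by (simp add: free_on_def)
    then show "coboundaries ?D (- 1) = free_vs.span (graph_rels Ass_gens (dgraphs Ass_gens 0 2 (- 1)) \<union>
        wheeled_ideal_gens Ass_gens Ass_rels 0 2 (- 1))"
      unfolding coboundaries_def wheeled_completion_def by auto
  qed (use middle_loop_dies in \<open>auto simp: graph_map_def lin_add free_vs.span_add free_vs.span_neg\<close>)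
  ultimately have "(+) ?z ` ?B = ?B"
    using inj unfolding inj_on_def by blast
  \<comment> \<open>Translating \<open>0\<close> by \<open>?z\<close> inside the coset equality
    places \<open>?z\<close> itself in \<open>?B\<close>.\<close>
  moreover have "0 \<in> ?B"
    unfolding coboundaries_def free_wheeled_def
    by (intro CollectI exI[of _ 0])
       (simp add: graph_diff_def free_on_def free_vs.span_zero)
  ultimately have "?z \<in> ?B"
    by (metis add.right_neutral image_eqI)
  then show False
    using middle_loop_not_exact by blast
qed

end
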